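(* Let $n$ be even, let $\mathcal{PM}$ be the family of all perfect matchings on $[n]$, let $M_0$ be the perfect matching with edge set $\{\{2i-1,2i\}:1\le i\le n/2\}$, and let $f:\mathbb N\to\mathbb N$ satisfy $f(n)=\omega(n^{3/4})$. Then with high probability $$n-f(n)\le \tau(\mathcal{PM},n)\le \tau_{\text{lab}}(M_0,n)=n-\Theta(\sqrt n).$$
   Context: Semi-random no-replacement multigraph process on $[n]=\{1,\dots,n\}$: let $\pi_1,\pi_2,\dots$ be independent uniformly random permutations in $S_n$. Builder's multigraph starts empty on $[n]$. In round $k\ge1$ Builder is offered the vertex $v_k:=\pi_{\lceil k/n\rceil}(k-\lfloor (k-1)/n\rfloor n)$; Builder then chooses a vertex $u_k$ according to his strategy (a rule depending on the history so far) and adds the edge $u_kv_k$ to his multigraph (multiple edges allowed). For a family $\mathcal F$ of labeled graphs on $[n]$ and a strategy $\mathcal S$, $\tau(\mathcal S)$ is the least $m$ such that Builder's multigraph after $m$ rounds contains some member of $\mathcal F$ as a subgraph ($+\infty$ if none). $\tau_{\text{lab}}(\mathcal F,n)$ is a random variable with $\Pr(\tau_{\text{lab}}(\mathcal F,n)\le k)=\max_{\mathcal S}\Pr(\tau(\mathcal S)\le k)$ for all $k\ge0$; $\tau(\mathcal F,n):=\tau_{\text{lab}}(\mathcal F_{\text{iso}},n)$, where $\mathcal F_{\text{iso}}$ is the set of labeled graphs on $[n]$ isomorphic to a member of $\mathcal F$; for a single graph $G$ write $\tau_{\text{lab}}(G,n)$, $\tau(G,n)$. These variables are coupled so that $\tau(\mathcal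 F,n)\le\tau_{\text{lab}}(\mathcal F,n)$. W.h.p. means with probability tending to $1$ as $n\to\infty$.
   Formalization: The equality n−Θ(√n) is proved in probability: for each ε>0 there are c,C>0 with n−C√n ≤ τ_lab(M_0,n) ≤ n−c√n with probability at least 1−ε for large even n; with fixed constants it is false, as P(τ_lab ≤ n−c√n) stays below 1 in the limit. *)

theory Defs
  imports
    "HOL-Probability.Probability"
    "HOL-Combinatorics.Permutations"
    "HOL-Library.Landau_Symbols"
begin

text \<open>A labeled graph on \<open>[n] = {1..n}\<close> is given by its set of edges, an edge being a
  two-element subset of \<open>[n]\<close>; the vertex set is always all of \<open>[n]\<close>.\<close>

definition labeled_graphs :: "nat \<Rightarrow> nat set set set" where
  "labeled_graphs n = Pow {e. e \<subseteq> {1..n} \<and> card e = 2}"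

definition iso_closure :: "nat \<Rightarrow> nat set set set \<Rightarrow> nat set set set" where
  "iso_closure n F =
     {H \<in> labeled_graphs n. \<exists>G\<in>F. \<exists>p. p permutes {1..n} \<and> H = (\<lambda>e. p ` e) ` G}"

definition perfect_matchings :: "nat \<Rightarrow> nat set set set" where
  "perfect_matchings n = {M \<in> labeled_graphs n. \<forall>v\<in>{1..n}. \<exists>!e. e \<in> M \<and> v \<in> e}"

definition M0 :: "nat \<Rightarrow> nat set set" where
  "M0 n = {{2 * i - 1, 2 * i} | i. 1 \<le> i \<and> i \<le> n div 2}"


definition perm_seq_space :: "nat \<Rightarrow> (nat \<Rightarrow> nat \<Rightarrow> nat) measure" where
  "perm_seq_space n = (\<Pi>\<^sub>M j\<in>{1..}. uniform_count_measure {p. p permutes {1..n}})"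

definition offered :: "nat \<Rightarrow> (nat \<Rightarrow> nat \<Rightarrow> nat) \<Rightarrow> nat \<Rightarrow> nat" where
  "offered n \<pi> k =
     \<pi> (nat \<lceil>real k / real n\<rceil>) (k - nat \<lfloor>(real k - 1) / real n\<rfloor> * n)"

text \<open>A strategy maps the history, i.e. the chronological list of the pairs \<open>(u\<^sub>i, v\<^sub>i)\<close> of all
  earlier rounds, together with the vertex currently offered, to the vertex chosen by Builder.
  Builder may choose the offered vertex itself; the resulting singleton \<open>{v}\<close> is an edge of no
  labeled graph.\<close>

type_synonym strategy = "(nat \<times> nat) list \<Rightarrow> nat \<Rightarrow> nat"

definition strategies :: "nat \<Rightarrow> strategy set" where
  "strategies n = {S. \<forall>h v. S h v \<in> {1..n}}"

fun history :: "strategy \<Rightarrow> (nat \<Rightarrow> nat) \<Rightarrow> nat \<Rightarrow> (nat \<times> nat) list" where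
  "history S v 0 = []"
| "history S v (Suc m) =
     history S v m @ [(S (history S v m) (v (Suc m)), v (Suc m))]"

definition multigraph :: "strategy \<Rightarrow> (nat \<Rightarrow> nat) \<Rightarrow> nat \<Rightarrow> nat set multiset" where
  "multigraph S v m = mset (map (\<lambda>(u, w). {u, w}) (history S v m))"

definition hit_time :: "nat \<Rightarrow> nat set set set \<Rightarrow> strategy \<Rightarrow> (nat \<Rightarrow> nat \<Rightarrow> nat) \<Rightarrow> enat" where
  "hit_time n F S \<pi> =
     Inf (enat ` {m. \<exists>G\<in>F. G \<subseteq> set_mset (multigraph S (offered n \<pi>) m)})"

definition hit_prob :: "nat \<Rightarrow> nat set set set \<Rightarrow> strategy \<Rightarrow> nat \<Rightarrow> real" where
  "hit_prob n F S k =
     measure (perm_seq_space n) {\<pi> \<in> space (perm_seq_space n). hit_time n F S \<pi> \<le> enat k}"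

text \<open>\<open>is_tau_lab M n F X\<close> says that the random variable \<open>X\<close> on \<open>M\<close> satisfies
  \<open>Pr (X \<le> k) = max\<^sub>S Pr (\<tau>(S) \<le> k)\<close> for all \<open>k\<close>; the maximum is spelled out as an attained
  upper bound.\<close>

definition is_tau_lab :: "'a measure \<Rightarrow> nat \<Rightarrow> nat set set set \<Rightarrow> ('a \<Rightarrow> enat) \<Rightarrow> bool" where
  "is_tau_lab M n F X \<longleftrightarrow>
     X \<in> M \<rightarrow>\<^sub>M count_space UNIV \<and>
     (\<forall>k::nat.
        (\<forall>S\<in>strategies n. hit_prob n F S k \<le> measure M {\<omega> \<in> space M. X \<omega> \<le> enat k}) \<and>
        (\<exists>S\<in>strategies n. hit_prob n F S k = measure M {\<omega> \<in> space M. X \<omega> \<le> enat k}))"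

text \<open>A realisation, on one probability space, of the variables \<open>\<tau>\<^sub>l\<^sub>a\<^sub>b(F, n)\<close> for all families
  \<open>F\<close> of labeled graphs on \<open>[n]\<close>, coupled so that \<open>\<tau>(F, n) = \<tau>\<^sub>l\<^sub>a\<^sub>b(F\<^sub>i\<^sub>s\<^sub>o, n) \<le> \<tau>\<^sub>l\<^sub>a\<^sub>b(F, n)\<close>.\<close>

definition tau_coupling ::
    "'a measure \<Rightarrow> nat \<Rightarrow> (nat set set set \<Rightarrow> 'a \<Rightarrow> enat) \<Rightarrow> bool" where
  "tau_coupling M n \<tau>lab \<longleftrightarrow>
     prob_space M \<and>
     (\<forall>F \<subseteq> labeled_graphs n. is_tau_lab M n F (\<tau>lab F)) \<and>
     (\<forall>F \<subseteq> labeled_graphs n. AE \<omega> in M. \<tau>lab (iso_closure n F) \<omega> \<le> \<tau>lab F \<omega>)"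


text \<open>The rest of this theory shows that such couplings exist for every \<open>n \<ge> 1\<close>.\<close>

lemma iso_closure_subset: "iso_closure n F \<subseteq> labeled_graphs n"
  by (auto simp: iso_closure_def)

lemma subset_iso_closure:
  assumes "F \<subseteq> labeled_graphs n"
  shows "F \<subseteq> iso_closure n F"
proof
  fix G assume G: "G \<in> F"
  have "id permutes {1..n}" by (rule permutes_id)
  moreover have "G = (\<lambda>e. id ` e) ` G" by simp
  ultimately show "G \<in> iso_closure n F"
    using G assms unfolding iso_closure_def by blast
qed

lemma prob_space_perm: "prob_space (uniform_count_measure {p. p permutes {1..n::nat}})"
  by (rule prob_space_uniform_count_measure)
    (use permutes_id[of "{1..n}"] finite_permutations[of "{1..n}"] in blast)+

lemma prob_space_perm_seq_space: "prob_space (perm_seq_space n)"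
  unfolding perm_seq_space_def by (rule prob_space_PiM) (rule prob_space_perm)

lemma ceiling_index_pos:
  assumes "1 \<le> k" "1 \<le> n"
  shows "1 \<le> nat \<lceil>real k / real n\<rceil>"
proof -
  have "0 < real k / real n" using assms by simp
  then have "0 < \<lceil>real k / real n\<rceil>" by (simp only: zero_less_ceiling)
  then show ?thesis by linarith
qed

lemma offset_in_range:
  assumes "1 \<le> k" "1 \<le> n"
  shows "k - nat \<lfloor>(real k - 1) / real n\<rfloor> * n \<in> {1..n}"
proof -
  obtain j where j: "k = Suc j" using assms by (cases k) auto
  have "nat \<lfloor>(real k - 1) / real n\<rfloor> = j div n"
    unfolding j by (simp add: floor_divide_of_nat_eq)
  moreover have "Suc j - j div n * n = Suc (j mod n)"
    using div_mult_mod_eq[of j n] by linarith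
  moreover have "j mod n < n" using assms by simp
  ultimately show ?thesis unfolding j by simp
qed

lemma offered_in_range:
  assumes "\<pi> \<in> space (perm_seq_space n)" "1 \<le> k" "1 \<le> n"
  shows "offered n \<pi> k \<in> {1..n}"
proof -
  have "\<pi> (nat \<lceil>real k / real n\<rceil>) permutes {1..n}"
    using assms(1) ceiling_index_pos[OF assms(2,3)]
    by (auto simp: perm_seq_space_def space_PiM space_uniform_count_measure PiE_iff)
  from permutes_in_image[OF this] show ?thesis
    unfolding offered_def using offset_in_range[OF assms(2,3)] by simp
qed

lemma measurable_offered:
  assumes "1 \<le> k" "1 \<le> n"
  shows "(\<lambda>\<pi>. offered n \<pi> k) \<in> perm_seq_space n \<rightarrow>\<^sub>M count_space UNIV"
proof -
  have "(\<lambda>\<pi>. \<pi> (nat \<lceil>real k / real n\<rceil>)) \<in>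
      perm_seq_space n \<rightarrow>\<^sub>M uniform_count_measure {p. p permutes {1..n}}"
    unfolding perm_seq_space_def
    by (rule measurable_component_singleton) (use ceiling_index_pos[OF assms] in simp)
  moreover have "(\<lambda>p. p (k - nat \<lfloor>(real k - 1) / real n\<rfloor> * n)) \<in>
      uniform_count_measure {p. p permutes {1..n}} \<rightarrow>\<^sub>M count_space UNIV"
    by (auto simp: measurable_def space_uniform_count_measure sets_uniform_count_measure)
  ultimately show ?thesis
    unfolding offered_def by (rule measurable_compose)
qed

lemma measurable_history:
  assumes "1 \<le> n"
  shows "(\<lambda>\<pi>. history S (offered n \<pi>) m) \<in> perm_seq_space n \<rightarrow>\<^sub>M count_space UNIV"
proof (induction m)
  case 0
  show ?case by simp
next
  case (Suc m)
  have v: "(\<lambda>\<pi>. offered n \<pi> (Suc m)) \<in> perm_seq_space n \<rightarrow>\<^sub>M count_space UNIV"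
    by (rule measurable_offered) (use assms in auto)
  have "(\<lambda>\<pi>. (\<lambda>h \<pi>. h @ [(S h (offered n \<pi> (Suc m)), offered n \<pi> (Suc m))])
            (history S (offered n \<pi>) m) \<pi>)
      \<in> perm_seq_space n \<rightarrow>\<^sub>M count_space UNIV"
  proof (rule measurable_compose_countable[OF _ Suc])
    fix h
    show "(\<lambda>\<pi>. h @ [(S h (offered n \<pi> (Suc m)), offered n \<pi> (Suc m))])
        \<in> perm_seq_space n \<rightarrow>\<^sub>M count_space UNIV"
      by (rule measurable_compose[OF v, where g = "\<lambda>w. h @ [(S h w, w)]"]) simp
  qed
  then show ?case by simp
qed

lemma Inf_enat_le_iff: "Inf (enat ` A) \<le> enat k \<longleftrightarrow> (\<exists>m\<in>A. m \<le> k)"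
proof
  assume "\<exists>m\<in>A. m \<le> k"
  then obtain m where m: "m \<in> A" "m \<le> k" by blast
  have "Inf (enat ` A) \<le> enat m" using m(1) by (intro Inf_lower imageI)
  also have "\<dots> \<le> enat k" using m(2) by simp
  finally show "Inf (enat ` A) \<le> enat k" .
next
  assume L: "Inf (enat ` A) \<le> enat k"
  then have "Inf (enat ` A) < enat (Suc k)"
    using order_le_less_trans[OF L, of "enat (Suc k)"] by simp
  then obtain m where "m \<in> A" "enat m < enat (Suc k)" by (auto simp: Inf_less_iff)
  then show "\<exists>m\<in>A. m \<le> k" using less_Suc_eq_le by auto
qed

lemma hit_time_le_iff:
  "hit_time n F S \<pi> \<le> enat k \<longleftrightarrow>
     (\<exists>m\<le>k. \<exists>G\<in>F. G \<subseteq> set_mset (multigraph S (offered n \<pi>) m))"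
  unfolding hit_time_def Inf_enat_le_iff by auto

lemma hit_event_measurable:
  assumes "1 \<le> n"
  shows "{\<pi> \<in> space (perm_seq_space n). hit_time n F S \<pi> \<le> enat k} \<in> sets (perm_seq_space n)"
proof -
  have "{\<pi> \<in> space (perm_seq_space n). hit_time n F S \<pi> \<le> enat k} =
     (\<Union>m\<le>k. (\<lambda>\<pi>. history S (offered n \<pi>) m) -`
        {h. \<exists>G\<in>F. G \<subseteq> set_mset (mset (map (\<lambda>(u, w). {u, w}) h))} \<inter> space (perm_seq_space n))"
    by (auto simp: hit_time_le_iff multigraph_def)
  also have "\<dots> \<in> sets (perm_seq_space n)"
    by (intro sets.finite_UN measurable_sets[OF measurable_history[OF assms]]) auto
  finally show ?thesis .
qed

lemma hit_prob_mono_time: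
  assumes "1 \<le> n" "k \<le> l"
  shows "hit_prob n F S k \<le> hit_prob n F S l"
proof -
  interpret prob_space "perm_seq_space n" by (rule prob_space_perm_seq_space)
  show ?thesis unfolding hit_prob_def
    by (rule finite_measure_mono[OF _ hit_event_measurable[OF assms(1)]])
      (use assms(2) in \<open>auto intro: order_trans\<close>)
qed

lemma hit_prob_mono_family:
  assumes "1 \<le> n" "F \<subseteq> F'"
  shows "hit_prob n F S k \<le> hit_prob n F' S k"
proof -
  interpret prob_space "perm_seq_space n" by (rule prob_space_perm_seq_space)
  show ?thesis unfolding hit_prob_def
    by (rule finite_measure_mono[OF _ hit_event_measurable[OF assms(1)]])
      (use assms(2) in \<open>auto simp: hit_time_le_iff\<close>)
qed

lemma finite_hit_probs:
  assumes n: "1 \<le> n"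
  shows "finite ((\<lambda>S. hit_prob n F S k) ` strategies n)"
proof -
  define D where "D = {h. set h \<subseteq> {1..n} \<times> {1..n} \<and> length h \<le> k} \<times> {1..n}"
  define trunc :: "strategy \<Rightarrow> (nat \<times> nat) list \<times> nat \<Rightarrow> nat"
    where "trunc S = restrict (\<lambda>(h, v). S h v) D" for S
  have "finite D" unfolding D_def
    by (intro finite_cartesian_product finite_lists_length_le) auto
  moreover have "trunc ` strategies n \<subseteq> (\<Pi>\<^sub>E x\<in>D. {1..n})"
    by (auto simp: trunc_def strategies_def)
  ultimately have fin: "finite (trunc ` strategies n)"
    by (meson finite_PiE finite_atLeastAtMost finite_subset)
  have eq: "hit_prob n F S k = hit_prob n F S' k"
    if S: "S \<in> strategies n" and S': "S' \<in> strategies n" and tr: "trunc S = trunc S'" for S S'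
  proof -
    have agree: "S h v = S' h v" if "(h, v) \<in> D" for h v
      using fun_cong[OF tr, of "(h, v)"] that by (simp add: trunc_def)
    have hist: "history S (offered n \<pi>) m = history S' (offered n \<pi>) m
        \<and> set (history S (offered n \<pi>) m) \<subseteq> {1..n} \<times> {1..n}
        \<and> length (history S (offered n \<pi>) m) = m"
      if "\<pi> \<in> space (perm_seq_space n)" "m \<le> k" for \<pi> m
      using that(2)
    proof (induction m)
      case 0
      show ?case by simp
    next
      case (Suc m)
      have v: "offered n \<pi> (Suc m) \<in> {1..n}"
        by (rule offered_in_range[OF that(1) _ n]) simp
      have u: "S' h w \<in> {1..n}" for h w using S' by (simp add: strategies_def)
      have "(history S (offered n \<pi>) m, offered n \<pi> (Suc m)) \<in> D"
        using Suc v unfolding D_def by auto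
      from agree[OF this] Suc v u show ?case by auto
    qed
    have "{\<pi> \<in> space (perm_seq_space n). hit_time n F S \<pi> \<le> enat k} =
          {\<pi> \<in> space (perm_seq_space n). hit_time n F S' \<pi> \<le> enat k}"
      unfolding hit_time_le_iff multigraph_def using hist by (intro Collect_cong) metis
    then show ?thesis by (simp add: hit_prob_def)
  qed
  have "(\<lambda>S. hit_prob n F S k) ` strategies n
      \<subseteq> (\<lambda>t. hit_prob n F (inv_into (strategies n) trunc t) k) ` (trunc ` strategies n)"
  proof
    fix x assume "x \<in> (\<lambda>S. hit_prob n F S k) ` strategies n"
    then obtain S where S: "S \<in> strategies n" "x = hit_prob n F S k" by auto
    let ?S' = "inv_into (strategies n) trunc (trunc S)"
    have "?S' \<in> strategies n" "trunc ?S' = trunc S"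
      using S(1) by (auto intro!: inv_into_into f_inv_into_f[of _ trunc])
    then have "x = hit_prob n F ?S' k" using eq S by metis
    then show "x \<in> (\<lambda>t. hit_prob n F (inv_into (strategies n) trunc t) k) ` (trunc ` strategies n)"
      using S(1) by blast
  qed
  then show ?thesis using fin by (meson finite_imageI finite_subset)
qed

lemma strategies_nonempty:
  assumes "1 \<le> n"
  shows "strategies n \<noteq> {}"
proof -
  have "(\<lambda>h v. 1) \<in> strategies n" using assms by (simp add: strategies_def)
  then show ?thesis by blast
qed

lemma tau_coupling_exists:
  assumes n: "1 \<le> n"
  shows "\<exists>\<tau>lab. tau_coupling (uniform_measure lborel {0<..<1::real}) n \<tau>lab"
proof -
  define q where "q F k = Max ((\<lambda>S. hit_prob n F S k) ` strategies n)" for F k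
  define \<tau>lab where "\<tau>lab F u = Inf (enat ` {k. u \<le> q F k})" for F and u :: real
  let ?M = "uniform_measure lborel {0<..<1::real}"
  have q_ge: "hit_prob n F S k \<le> q F k" if "S \<in> strategies n" for F S k
    unfolding q_def using that by (intro Max_ge finite_hit_probs[OF n]) auto
  have q_att: "\<exists>S\<in>strategies n. hit_prob n F S k = q F k" for F k
  proof -
    have "q F k \<in> (\<lambda>S. hit_prob n F S k) ` strategies n"
      unfolding q_def using strategies_nonempty[OF n] by (intro Max_in finite_hit_probs[OF n]) auto
    then show ?thesis by auto
  qed
  have q01: "0 \<le> q F k \<and> q F k \<le> 1" for F k
  proof -
    interpret prob_space "perm_seq_space n" by (rule prob_space_perm_seq_space)
    show ?thesis using q_att[of F k] unfolding hit_prob_def by (metis measure_nonneg prob_le_1)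
  qed
  have q_mono: "q F k \<le> q F l" if "k \<le> l" for F k l
    using q_att[of F k] q_ge[of _ F l] hit_prob_mono_time[OF n that] by (metis order_trans)
  have q_fam: "q F k \<le> q F' k" if "F \<subseteq> F'" for F F' k
    using q_att[of F k] q_ge[of _ F' k] hit_prob_mono_family[OF n that] by (metis order_trans)
  have tau_le: "\<tau>lab F u \<le> enat k \<longleftrightarrow> u \<le> q F k" for F u k
    unfolding \<tau>lab_def Inf_enat_le_iff using q_mono[of _ k F] by (auto intro: order_trans)
  have P: "prob_space ?M"
    by (rule prob_space_uniform_measure) auto
  have cdf: "measure ?M {u \<in> space ?M. \<tau>lab F u \<le> enat k} = q F k" for F k
  proof -
    have "measure ?M {u \<in> space ?M. \<tau>lab F u \<le> enat k} = measure ?M {..q F k}"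
      by (simp add: tau_le atMost_def)
    also have "\<dots> = measure lborel ({0<..<1} \<inter> {..q F k})"
      by (subst measure_uniform_measure) auto
    also have "{0<..<1} \<inter> {..q F k} = (if q F k = 1 then {0<..<1} else {0<..q F k})"
      using q01[of F k] by auto
    also have "measure lborel \<dots> = q F k" using q01[of F k] by auto
    finally show ?thesis .
  qed
  have meas: "\<tau>lab F \<in> ?M \<rightarrow>\<^sub>M count_space UNIV" for F
  proof -
    have le: "{u. \<tau>lab F u \<le> enat k} \<in> sets borel" for k
      by (simp add: tau_le flip: atMost_def)
    have fin: "\<tau>lab F -` {enat k} \<in> sets borel" for k
    proof (cases k)
      case 0
      have "\<tau>lab F -` {enat k} = {u. \<tau>lab F u \<le> enat 0}"
        using 0 by (auto simp: zero_enat_def[symmetric])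
      then show ?thesis using le by simp
    next
      case (Suc j)
      have "x = enat (Suc j) \<longleftrightarrow> x \<le> enat (Suc j) \<and> \<not> x \<le> enat j" for x
        by (cases x) auto
      then have "\<tau>lab F -` {enat k} = {u. \<tau>lab F u \<le> enat (Suc j)} - {u. \<tau>lab F u \<le> enat j}"
        using Suc by auto
      then show ?thesis using le by auto
    qed
    have inf: "\<tau>lab F -` {\<infinity>} \<in> sets borel"
    proof -
      have "x = \<infinity> \<longleftrightarrow> (\<forall>k. x \<noteq> enat k)" for x by (cases x) auto
      then have "\<tau>lab F -` {\<infinity>} = UNIV - (\<Union>k. \<tau>lab F -` {enat k})" by auto
      then show ?thesis using fin by auto
    qed
    have "\<tau>lab F -` {x} \<in> sets borel" for x
      using fin inf by (cases x) auto
    then have "\<tau>lab F \<in> borel \<rightarrow>\<^sub>M count_space UNIV"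
      by (subst measurable_count_space_eq_countable) auto
    then show ?thesis by (simp add: measurable_def)
  qed
  have "is_tau_lab ?M n F (\<tau>lab F)" for F
    unfolding is_tau_lab_def cdf using meas q_ge q_att by blast
  moreover have "\<tau>lab (iso_closure n F) u \<le> \<tau>lab F u" if "F \<subseteq> labeled_graphs n" for F u
  proof (cases "\<tau>lab F u")
    case (enat k)
    then have "u \<le> q F k" using tau_le[of F u k] by simp
    then show ?thesis
      using enat q_fam[OF subset_iso_closure[OF that]] tau_le by (metis order_trans)
  qed auto
  ultimately have "tau_coupling ?M n \<tau>lab"
    unfolding tau_coupling_def using P by auto
  then show ?thesis by blast
qed

end

theory Submission
  imports Defs "HOL-Real_Asymp.Real_Asymp"
begin

text \<open>
  Within the first \<open>n\<close> rounds every offered vertex is new. Orient each edge from the offered vertex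
  to the chosen one: every component is then either a tree whose root is its only vertex not yet
  offered, or contains a cycle and no such vertex. A perfect matching forces all trees to have even
  size. Offering the root of an even tree does not change the number of odd trees, and offering the
  root of an odd tree lowers it by at most two. If \<open>s\<close> vertices have not been offered and \<open>e\<close> is half
  the number of odd trees, rounded up, then \<open>(1 - t (t - 1) / (s (s - 1))) ^ e\<close> is therefore a
  supermartingale by Bernoulli's inequality. At \<open>s = t\<close> it is the indicator of \<open>e = 0\<close>, so no
  strategy has a perfect matching after \<open>n - t\<close> rounds with probability more than
  \<open>exp (- t (t - 1) / (2 n))\<close>. This gives both lower bounds. For the upper bound Builder always joins
  the offered vertex to its partner in \<open>M\<^sub>0\<close>, which fails only if some pair is missed entirely.
\<close>

subsection \<open>Revealing a random permutation entry by entry\<close>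

definition seq_prefix :: "(nat \<Rightarrow> nat) \<Rightarrow> nat \<Rightarrow> nat list" where
  "seq_prefix v m = map v [1..<Suc m]"

lemma seq_prefix_0 [simp]: "seq_prefix v 0 = []"
  by (simp add: seq_prefix_def)

lemma seq_prefix_Suc [simp]: "seq_prefix v (Suc m) = seq_prefix v m @ [v (Suc m)]"
  by (simp add: seq_prefix_def)

lemma length_seq_prefix [simp]: "length (seq_prefix v m) = m"
  by (simp add: seq_prefix_def)

lemma set_seq_prefix: "set (seq_prefix v m) = v ` {1..m}"
  by (auto simp: seq_prefix_def)

lemma seq_prefix_cong:
  assumes "\<And>i. 1 \<le> i \<Longrightarrow> i \<le> m \<Longrightarrow> v i = w i"
  shows "seq_prefix v m = seq_prefix w m"
  using assms by (auto simp: seq_prefix_def)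

lemma distinct_seq_prefix:
  assumes "p permutes {1..n}" "m \<le> n"
  shows "distinct (seq_prefix p m)" and "set (seq_prefix p m) \<subseteq> {1..n}"
proof -
  have "inj_on p (set [1..<Suc m])"
    using permutes_inj[OF assms(1)] by (rule inj_on_subset) simp
  then show "distinct (seq_prefix p m)" by (simp add: seq_prefix_def distinct_map del: upt_Suc)
  show "set (seq_prefix p m) \<subseteq> {1..n}"
    using permutes_in_image[OF assms(1)] assms(2) by (fastforce simp: set_seq_prefix)
qed

lemma permutes_image_tail:
  assumes "p permutes {1..n}" "m \<le> n"
  shows "p ` {Suc m..n} = {1..n} - set (seq_prefix p m)"
proof -
  have "{Suc m..n} = {1..n} - {1..m}" by auto
  then show ?thesis
    using image_set_diff[OF permutes_inj[OF assms(1)], of "{1..n}" "{1..m}"]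
      permutes_image[OF assms(1)] by (simp add: set_seq_prefix)
qed

text \<open>Composing with the transposition of \<open>Suc k\<close> and \<open>j > k\<close> is an
  involution on permutations that keeps the first \<open>k\<close> entries. Hence all
  \<open>n - k\<close> later positions may stand in for the next one, and together they run through
  the values not yet used.\<close>

lemma sum_permutes_next:
  fixes F :: "nat list \<Rightarrow> real"
  assumes k: "k < n"
  shows "real (n - k) * (\<Sum>p | p permutes {1..n}. F (seq_prefix p (Suc k))) =
    (\<Sum>p | p permutes {1..n}. \<Sum>v \<in> {1..n} - set (seq_prefix p k). F (seq_prefix p k @ [v]))"
proof -
  let ?P = "{p. p permutes {1..n}}"
  have swap: "(\<Sum>p\<in>?P. F (seq_prefix p (Suc k))) = (\<Sum>p\<in>?P. F (seq_prefix p k @ [p j]))"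
    if j: "j \<in> {Suc k..n}" for j
  proof (rule sum.reindex_bij_witness[where i = "\<lambda>p. p \<circ> Transposition.transpose (Suc k) j"
        and j = "\<lambda>p. p \<circ> Transposition.transpose (Suc k) j"])
    fix p assume p: "p \<in> ?P"
    have "Transposition.transpose (Suc k) j permutes {1..n}"
      using j k by (intro permutes_swap_id) auto
    then show "p \<circ> Transposition.transpose (Suc k) j \<in> ?P" using p by (auto intro: permutes_compose)
    then show "p \<circ> Transposition.transpose (Suc k) j \<in> ?P" .
    have "seq_prefix (p \<circ> Transposition.transpose (Suc k) j) k = seq_prefix p k"
      using j by (intro seq_prefix_cong) (auto simp: Transposition.transpose_def)
    then show "F (seq_prefix (p \<circ> Transposition.transpose (Suc k) j) k @ [(p \<circ> Transposition.transpose (Suc k) j) j]) =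
        F (seq_prefix p (Suc k))" by simp
  qed (auto simp: comp_assoc)
  have "real (n - k) * (\<Sum>p\<in>?P. F (seq_prefix p (Suc k))) =
      (\<Sum>j\<in>{Suc k..n}. \<Sum>p\<in>?P. F (seq_prefix p (Suc k)))"
    by simp
  also have "\<dots> = (\<Sum>j\<in>{Suc k..n}. \<Sum>p\<in>?P. F (seq_prefix p k @ [p j]))"
    by (rule sum.cong[OF refl swap])
  also have "\<dots> = (\<Sum>p\<in>?P. \<Sum>j\<in>{Suc k..n}. F (seq_prefix p k @ [p j]))"
    by (rule sum.swap)
  also have "\<dots> = (\<Sum>p\<in>?P. \<Sum>v \<in> {1..n} - set (seq_prefix p k). F (seq_prefix p k @ [v]))"
  proof (rule sum.cong[OF refl])
    fix p assume "p \<in> ?P"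
    then have p: "p permutes {1..n}" by simp
    have "inj_on p {Suc k..n}" using permutes_inj[OF p] by (rule inj_on_subset) simp
    from sum.reindex[OF this, of "\<lambda>v. F (seq_prefix p k @ [v])"]
    show "(\<Sum>j\<in>{Suc k..n}. F (seq_prefix p k @ [p j])) =
        (\<Sum>v \<in> {1..n} - set (seq_prefix p k). F (seq_prefix p k @ [v]))"
      using permutes_image_tail[OF p] k by simp
  qed
  finally show ?thesis .
qed

lemma sum_permutes_supermartingale:
  fixes F :: "nat list \<Rightarrow> real"
  assumes step: "\<And>xs. distinct xs \<Longrightarrow> set xs \<subseteq> {1..n} \<Longrightarrow> length xs < m \<Longrightarrow>
      (\<Sum>v \<in> {1..n} - set xs. F (xs @ [v])) \<le> real (n - length xs) * F xs"
    and m: "m \<le> n"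
  shows "(\<Sum>p | p permutes {1..n}. F (seq_prefix p m)) \<le> fact n * F []"
  using step m
proof (induction m)
  case 0
  then show ?case by (simp add: card_permutations)
next
  case (Suc m)
  have "real (n - m) * (\<Sum>p | p permutes {1..n}. F (seq_prefix p (Suc m))) =
    (\<Sum>p | p permutes {1..n}. \<Sum>v \<in> {1..n} - set (seq_prefix p m). F (seq_prefix p m @ [v]))"
    using Suc.prems by (intro sum_permutes_next) simp
  also have "\<dots> \<le> (\<Sum>p | p permutes {1..n}. real (n - m) * F (seq_prefix p m))"
  proof (rule sum_mono)
    fix p assume "p \<in> {p. p permutes {1..n}}"
    then show "(\<Sum>v \<in> {1..n} - set (seq_prefix p m). F (seq_prefix p m @ [v])) \<le> real (n - m) * F (seq_prefix p m)"
      using Suc.prems(1)[of "seq_prefix p m"] distinct_seq_prefix[of p n m] Suc.prems(2) by simp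
  qed
  also have "\<dots> = real (n - m) * (\<Sum>p | p permutes {1..n}. F (seq_prefix p m))"
    by (simp add: sum_distrib_left)
  finally have "(\<Sum>p | p permutes {1..n}. F (seq_prefix p (Suc m))) \<le> (\<Sum>p | p permutes {1..n}. F (seq_prefix p m))"
    using Suc.prems(2) by simp
  also have "\<dots> \<le> fact n * F []" using Suc by simp
  finally show ?case .
qed

section \<open>The game as a function of the list of offered vertices\<close>

definition play :: "strategy \<Rightarrow> nat list \<Rightarrow> (nat \<times> nat) list" where
  "play S xs = foldl (\<lambda>h v. h @ [(S h v, v)]) [] xs"

lemma play_Nil [simp]: "play S [] = []"
  by (simp add: play_def)

lemma play_snoc [simp]: "play S (xs @ [v]) = play S xs @ [(S (play S xs) v, v)]"
  by (simp add: play_def)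

lemma history_eq_play: "history S v m = play S (seq_prefix v m)"
  by (induction m) auto

definition contains :: "nat set set set \<Rightarrow> (nat \<times> nat) list \<Rightarrow> bool" where
  "contains F h \<longleftrightarrow> (\<exists>G\<in>F. G \<subseteq> (\<lambda>(u, w). {u, w}) ` set h)"

lemma set_history_mono: "m \<le> k \<Longrightarrow> set (history S v m) \<subseteq> set (history S v k)"
  by (induction k) (auto simp: le_Suc_eq)

text \<open>Edges are never removed, so a success at some round up to \<open>k\<close> is still
  visible at round \<open>k\<close>.\<close>

lemma hit_time_le_iff_contains:
  "hit_time n F S \<pi> \<le> enat k \<longleftrightarrow> contains F (play S (seq_prefix (offered n \<pi>) k))"
proof -
  have "G \<subseteq> (\<lambda>(u, w). {u, w}) ` set (history S (offered n \<pi>) k)"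
    if "m \<le> k" "G \<subseteq> (\<lambda>(u, w). {u, w}) ` set (history S (offered n \<pi>) m)" for G m
    using that set_history_mono[of m k S] by (blast intro: order_trans)
  then show ?thesis
    unfolding hit_time_le_iff multigraph_def contains_def history_eq_play[symmetric]
    by (auto simp del: history.simps) blast
qed

lemma offered_first_block:
  assumes "1 \<le> k" "k \<le> n"
  shows "offered n \<pi> k = \<pi> 1 k"
proof -
  have "\<lceil>real k / real n\<rceil> = 1" "\<lfloor>(real k - 1) / real n\<rfloor> = 0"
    using assms by (auto simp: ceiling_eq_iff floor_eq_iff field_simps)
  then show ?thesis by (simp add: offered_def)
qed

text \<open>The first coordinate of the product measure is uniform, which turns probabilities into
  counts of permutations.\<close>

lemma measure_perm_seq_space_first:
  "measure (perm_seq_space n) {\<pi> \<in> space (perm_seq_space n). Q (\<pi> 1)} =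
     real (card {p. p permutes {1..n} \<and> Q p}) / fact n"
proof -
  let ?P = "{p. p permutes {1..n::nat}}" and ?U = "uniform_count_measure {p. p permutes {1..n::nat}}"
  have fin: "finite ?P" by (simp add: finite_permutations)
  have first: "\<pi> 1 permutes {1..n}" if "\<pi> \<in> space (perm_seq_space n)" for \<pi>
    using that by (auto simp: perm_seq_space_def space_PiM space_uniform_count_measure PiE_iff)
  have "distr (perm_seq_space n) ?U (\<lambda>\<pi>. \<pi> 1) = ?U"
    unfolding perm_seq_space_def by (rule distr_PiM_component) (simp_all only: prob_space_perm atLeast_iff order_refl)
  then have "measure ?U {p\<in>?P. Q p} = measure (distr (perm_seq_space n) ?U (\<lambda>\<pi>. \<pi> 1)) {p\<in>?P. Q p}"
    by simp
  also have "\<dots> = measure (perm_seq_space n) ((\<lambda>\<pi>. \<pi> 1) -` {p\<in>?P. Q p} \<inter> space (perm_seq_space n))"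
    unfolding perm_seq_space_def
    by (intro measure_distr measurable_component_singleton) (auto simp: sets_uniform_count_measure)
  also have "(\<lambda>\<pi>. \<pi> 1) -` {p\<in>?P. Q p} \<inter> space (perm_seq_space n) =
      {\<pi> \<in> space (perm_seq_space n). Q (\<pi> 1)}"
    using first by auto
  finally show ?thesis
    using measure_uniform_count_measure[OF fin, of "{p\<in>?P. Q p}"]
    by (simp add: card_permutations subset_eq)
qed

lemma hit_prob_eq_card:
  assumes "k \<le> n"
  shows "hit_prob n F S k =
    real (card {p. p permutes {1..n} \<and> contains F (play S (seq_prefix p k))}) / fact n"
proof -
  have "seq_prefix (offered n \<pi>) k = seq_prefix (\<pi> 1) k" for \<pi>
    using assms by (intro seq_prefix_cong offered_first_block) auto
  then show ?thesis
    unfolding hit_prob_def hit_time_le_iff_contains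
    using measure_perm_seq_space_first[of n "\<lambda>p. contains F (play S (seq_prefix p k))"] by simp
qed

subsection \<open>Parity of the trees\<close>

text \<open>The label of a vertex is the root of its tree; the label \<open>0\<close>, which is not a vertex, marks the
  components containing a cycle.\<close>

definition comp_root :: "(nat \<times> nat) list \<Rightarrow> nat \<Rightarrow> nat" where
  "comp_root h = foldl (\<lambda>L (u, v) x. if L x = v then (if L u = v then 0 else L u) else L x) id h"

lemma comp_root_Nil [simp]: "comp_root [] x = x"
  by (simp add: comp_root_def)

lemma comp_root_snoc:
  "comp_root (h @ [(u, v)]) x =
     (if comp_root h x = v then (if comp_root h u = v then 0 else comp_root h u) else comp_root h x)"
  by (simp add: comp_root_def)

definition comp_class :: "nat \<Rightarrow> (nat \<times> nat) list \<Rightarrow> nat \<Rightarrow> nat set" where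
  "comp_class n h x = {y \<in> {1..n}. comp_root h y = x}"

lemma finite_comp_class [simp]: "finite (comp_class n h x)"
  by (simp add: comp_class_def)

text \<open>Excluding the label \<open>0\<close> disregards all components with a cycle. This is
  harmless for a necessary condition on perfect matchings, and it makes every counted component a
  tree with an unoffered root.\<close>

definition odd_roots :: "nat \<Rightarrow> (nat \<times> nat) list \<Rightarrow> nat set" where
  "odd_roots n h = {x \<in> {1..n}. odd (card (comp_class n h x))}"

lemma finite_odd_roots [simp]: "finite (odd_roots n h)"
  by (simp add: odd_roots_def)

lemma odd_roots_Nil: "odd_roots n [] = {1..n}"
proof -
  have "comp_class n [] x = {x}" if "x \<in> {1..n}" for x
    using that by (auto simp: comp_class_def)
  then show ?thesis by (auto simp: odd_roots_def)
qed

text \<open>The three invariants need each other, so one induction proves all of them. Offering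
  \<open>v\<close> relabels the whole tree of \<open>v\<close> by the label of \<open>u\<close>, or
  by \<open>0\<close> if \<open>u\<close> lies in that tree; the label \<open>v\<close> then
  disappears for good.\<close>

lemma comp_root_play:
  assumes "distinct xs" "set xs \<subseteq> {1..n}"
  shows comp_root_unseen: "x \<notin> set xs \<Longrightarrow> comp_root (play S xs) x = x"
    and comp_root_not_seen: "comp_root (play S xs) y \<notin> set xs"
    and comp_root_edge: "(u, w) \<in> set (play S xs) \<Longrightarrow>
      comp_root (play S xs) u = comp_root (play S xs) w"
proof -
  have "(\<forall>x. x \<notin> set xs \<longrightarrow> comp_root (play S xs) x = x) \<and>
      (\<forall>y. comp_root (play S xs) y \<notin> set xs) \<and>
      (\<forall>(u, w) \<in> set (play S xs). comp_root (play S xs) u = comp_root (play S xs) w)"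
    using assms
  proof (induction xs rule: rev_induct)
    case (snoc v xs)
    then have IH: "x \<notin> set xs \<Longrightarrow> comp_root (play S xs) x = x"
        "comp_root (play S xs) y \<notin> set xs"
        "(u, w) \<in> set (play S xs) \<Longrightarrow> comp_root (play S xs) u = comp_root (play S xs) w"
      for x y u w by auto
    \<comment> \<open>A newly offered vertex is still the root of its tree, and the cycle label
      \<open>0\<close> can never be an offered vertex.\<close>
    have v: "comp_root (play S xs) v = v" "v \<noteq> 0" "0 \<notin> set xs"
      using snoc.prems IH(1) by auto
    show ?case
      using IH(1,2) v by (auto simp: comp_root_snoc dest: IH(3))
  qed auto
  then show "x \<notin> set xs \<Longrightarrow> comp_root (play S xs) x = x"
    "comp_root (play S xs) y \<notin> set xs"
    "(u, w) \<in> set (play S xs) \<Longrightarrow> comp_root (play S xs) u = comp_root (play S xs) w"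
    by auto
qed

lemma odd_roots_unseen:
  assumes "distinct xs" "set xs \<subseteq> {1..n}"
  shows "odd_roots n (play S xs) \<subseteq> {1..n} - set xs"
proof -
  have "comp_class n (play S xs) x = {}" if "x \<in> set xs" for x
    using comp_root_not_seen[OF assms] that by (auto simp: comp_class_def)
  then show ?thesis by (auto simp: odd_roots_def)
qed

lemma comp_class_snoc:
  assumes "x \<noteq> 0"
  shows "comp_class n (h @ [(u, v)]) x =
    (if x = v then {}
     else if x = comp_root h u then comp_class n h x \<union> comp_class n h v
     else comp_class n h x)"
  using assms by (auto simp: comp_class_def comp_root_snoc)

text \<open>Only the class of the label of \<open>u\<close> grows, by a disjoint union with the
  class of \<open>v\<close>, so the two parities add modulo 2.\<close>

lemma odd_card_comp_class_snoc:
  assumes "x \<noteq> 0" "x \<noteq> v"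
  shows "odd (card (comp_class n (h @ [(u, v)]) x)) \<longleftrightarrow>
    odd (card (comp_class n h x)) \<noteq> (x = comp_root h u \<and> odd (card (comp_class n h v)))"
proof -
  have "comp_class n h x \<inter> comp_class n h v = {}"
    using assms by (auto simp: comp_class_def)
  then show ?thesis using assms by (auto simp: comp_class_snoc card_Un_disjoint)
qed

text \<open>Merging an even tree into another component flips no parity, and the emptied class of
  \<open>v\<close> is even as before.\<close>

lemma odd_roots_snoc_even:
  assumes "v \<in> {1..n}" "v \<notin> odd_roots n h"
  shows "odd_roots n (h @ [(u, v)]) = odd_roots n h"
proof -
  have ev: "even (card (comp_class n h v))" using assms by (auto simp: odd_roots_def)
  have "odd (card (comp_class n (h @ [(u, v)]) x)) \<longleftrightarrow> odd (card (comp_class n h x))"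
    if "x \<in> {1..n}" for x
  proof (cases "x = v")
    case True
    then show ?thesis using ev that by (simp add: comp_class_snoc)
  next
    case False
    then show ?thesis using ev that by (subst odd_card_comp_class_snoc) auto
  qed
  then show ?thesis by (auto simp: odd_roots_def)
qed

text \<open>The only labels whose class can change are \<open>v\<close> and the label of
  \<open>u\<close>.\<close>

lemma odd_roots_snoc_superset:
  "odd_roots n h - {v, comp_root h u} \<subseteq> odd_roots n (h @ [(u, v)])"
proof
  fix x assume x: "x \<in> odd_roots n h - {v, comp_root h u}"
  then have "odd (card (comp_class n (h @ [(u, v)]) x))"
    by (subst odd_card_comp_class_snoc) (auto simp: odd_roots_def)
  then show "x \<in> odd_roots n (h @ [(u, v)])" using x by (auto simp: odd_roots_def)
qed

lemma card_odd_roots_snoc: "card (odd_roots n h) \<le> card (odd_roots n (h @ [(u, v)])) + 2"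
proof -
  have "card (odd_roots n h) - card {v, comp_root h u} \<le> card (odd_roots n h - {v, comp_root h u})"
    by (rule diff_card_le_card_Diff) simp
  also have "\<dots> \<le> card (odd_roots n (h @ [(u, v)]))"
    by (intro card_mono odd_roots_snoc_superset) simp
  finally show ?thesis by (simp add: card_insert_if split: if_splits)
qed

text \<open>The matching edges inside \<open>C\<close> are disjoint pairs, and closedness makes them
  cover \<open>C\<close>.\<close>

lemma card_perfect_matching_closed:
  assumes M: "M \<in> perfect_matchings n" and C: "C \<subseteq> {1..n}"
    and closed: "\<And>e. e \<in> M \<Longrightarrow> e \<inter> C \<noteq> {} \<Longrightarrow> e \<subseteq> C"
  shows "card C = 2 * card {e \<in> M. e \<subseteq> C}"
proof -
  let ?E = "{e \<in> M. e \<subseteq> C}"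
  have Mg: "e \<subseteq> {1..n}" "card e = 2" if "e \<in> M" for e
    using M that by (auto simp: perfect_matchings_def labeled_graphs_def)
  have ex: "\<exists>!e. e \<in> M \<and> v \<in> e" if "v \<in> {1..n}" for v
    using M that by (auto simp: perfect_matchings_def)
  have "C = \<Union> ?E"
  proof
    show "C \<subseteq> \<Union> ?E"
    proof
      fix v assume v: "v \<in> C"
      then obtain e where e: "e \<in> M" "v \<in> e" using ex C by blast
      then have "e \<subseteq> C" using closed v by blast
      then show "v \<in> \<Union> ?E" using e by blast
    qed
  qed auto
  moreover have "card (\<Union> ?E) = (\<Sum>e\<in>?E. card e)"
  proof (rule card_Union_disjoint)
    show "pairwise disjnt ?E"
      using ex C unfolding pairwise_def disjnt_def by blast
    show "finite e" if "e \<in> ?E" for e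
      using that C by (auto intro: finite_subset)
  qed
  moreover have "(\<Sum>e\<in>?E. card e) = 2 * card ?E" using Mg(2) by simp
  ultimately show ?thesis by simp
qed

text \<open>A matching edge is an edge of Builder's graph, so both ends carry the same label and
  every class is closed under the matching.\<close>

lemma odd_roots_perfect_matching:
  assumes "contains (perfect_matchings n) (play S xs)" "distinct xs" "set xs \<subseteq> {1..n}"
  shows "odd_roots n (play S xs) = {}"
proof -
  obtain M where M: "M \<in> perfect_matchings n" "M \<subseteq> (\<lambda>(u, w). {u, w}) ` set (play S xs)"
    using assms(1) by (auto simp: contains_def)
  have "card (comp_class n (play S xs) x) = 2 * card {e \<in> M. e \<subseteq> comp_class n (play S xs) x}" for x
  proof (rule card_perfect_matching_closed[OF M(1)])
    fix e assume e: "e \<in> M" "e \<inter> comp_class n (play S xs) x \<noteq> {}"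
    then obtain u w where uw: "(u, w) \<in> set (play S xs)" "e = {u, w}" using M(2) by blast
    have "e \<subseteq> {1..n}" using M(1) e(1) by (auto simp: perfect_matchings_def labeled_graphs_def)
    then show "e \<subseteq> comp_class n (play S xs) x"
      using e(2) uw comp_root_edge[OF assms(2,3) uw(1)] by (auto simp: comp_class_def)
  qed (auto simp: comp_class_def)
  then show ?thesis by (auto simp: odd_roots_def)
qed

section \<open>The supermartingale and the bound for perfect matchings\<close>

lemma power_add_ge:
  fixes a d :: real
  assumes "0 \<le> a" "0 \<le> d"
  shows "a ^ e + real e * d * a ^ (e - 1) \<le> (a + d) ^ e"
proof (induction e)
  case (Suc e)
  have "a ^ Suc e + real (Suc e) * d * a ^ (Suc e - 1) \<le> (a + d) * (a ^ e + real e * d * a ^ (e - 1))"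
  proof (cases e)
    case 0
    then show ?thesis by simp
  next
    case (Suc j)
    \<comment> \<open>This second-order term is all that is left over when the product is expanded.
      The form without division by \<open>a\<close> is Bernoulli's inequality including
      \<open>a = 0\<close>, the value of \<open>pair_missed t t\<close>.\<close>
    have "0 \<le> d * (real e * d * a ^ j)" using assms by simp
    then show ?thesis using Suc by (simp add: algebra_simps)
  qed
  also have "\<dots> \<le> (a + d) * (a + d) ^ e" using Suc assms by (intro mult_left_mono) auto
  finally show ?case by simp
qed simp

text \<open>The probability that a fixed pair is not contained in a random \<open>t\<close>-subset of an \<open>s\<close>-set.\<close>

definition pair_missed :: "nat \<Rightarrow> nat \<Rightarrow> real" where
  "pair_missed t s = 1 - real t * (real t - 1) / (real s * (real s - 1))"

lemma pair_missed_bounds: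
  assumes "2 \<le> t" "t \<le> s"
  shows "0 \<le> pair_missed t s" "pair_missed t s \<le> 1"
proof -
  have "real t * (real t - 1) \<le> real s * (real s - 1)"
    using assms by (intro mult_mono) auto
  then show "0 \<le> pair_missed t s" using assms by (simp add: pair_missed_def)
  show "pair_missed t s \<le> 1" using assms by (simp add: pair_missed_def)
qed

text \<open>Choose the \<open>t\<close>-subset by first deleting a random element of the larger set.
  With probability \<open>2 / Suc s\<close> the deletion hits the pair, which is then surely missed;
  otherwise the probability for \<open>s\<close> remains.\<close>

lemma pair_missed_Suc:
  assumes "2 \<le> s"
  shows "pair_missed t (Suc s) =
    pair_missed t s + 2 * (1 - pair_missed t s) / real (Suc s)"
proof -
  define r where "r = real t * (real t - 1) / (real s * (real s - 1))"
  have "real s - 1 \<noteq> 0" using assms by auto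
  then have "real t * (real t - 1) / ((real s + 1) * real s) = r * (real s - 1) / (real s + 1)"
    by (simp add: r_def)
  then have "pair_missed t (Suc s) = 1 - r * (real s - 1) / (real s + 1)"
    by (simp add: pair_missed_def add.commute)
  also have "\<dots> = 1 - r + 2 * (1 - (1 - r)) / real (Suc s)"
    by (simp add: field_simps)
  finally show ?thesis by (simp add: pair_missed_def r_def)
qed

text \<open>Rounding up keeps the exponent integral: it still drops by at most one per round, and the
  probability of a drop is at most \<open>2 e / s\<close>.\<close>

definition oddness :: "nat \<Rightarrow> (nat \<times> nat) list \<Rightarrow> nat" where
  "oddness n h = (card (odd_roots n h) + 1) div 2"

text \<open>At most \<open>2 * e\<close> of the unoffered vertices are odd roots, and only these can
  lower the exponent, each by at most one. So the mean is at most
  \<open>q ^ e + e * d * q ^ (e - 1)\<close> with \<open>d = 2 * (1 - q) / Suc s\<close>, to which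
  Bernoulli's inequality applies.\<close>

lemma oddness_step:
  assumes t: "2 \<le> t" and xs: "distinct xs" "set xs \<subseteq> {1..n}" "length xs < n - t"
  shows "(\<Sum>v \<in> {1..n} - set xs. pair_missed t (n - length (xs @ [v])) ^ oddness n (play S (xs @ [v])))
    \<le> real (n - length xs) * pair_missed t (n - length xs) ^ oddness n (play S xs)"
proof -
  define h where "h = play S xs"
  define A where "A = odd_roots n h"
  define U where "U = {1..n} - set xs"
  \<comment> \<open>The number of unoffered vertices after the coming round;
    \<open>undefined\<close> is a dummy, as only the length counts.\<close>
  define s where "s = n - length (xs @ [undefined])"
  define q where "q = pair_missed t s"
  define e where "e = oddness n h"
  have s: "n - length (xs @ [v]) = s" for v by (simp add: s_def)
  have Suc_s: "n - length xs = Suc s" "t \<le> s" using xs(3) by (auto simp: s_def)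
  have cardU: "card U = Suc s"
    using xs Suc_s by (simp add: U_def card_Diff_subset distinct_card)
  have finU: "finite U" by (simp add: U_def)
  have AU: "A \<subseteq> U" unfolding A_def U_def h_def by (rule odd_roots_unseen[OF xs(1,2)])
  have q: "0 \<le> q" "q \<le> 1" unfolding q_def using pair_missed_bounds[OF t Suc_s(2)] by auto
  have "q ^ oddness n (play S (xs @ [v])) \<le> (if v \<in> A then q ^ (e - 1) else q ^ e)"
    if v: "v \<in> U" for v
  proof (cases "v \<in> A")
    case True
    have "e - 1 \<le> oddness n (play S (xs @ [v]))"
      using card_odd_roots_snoc[of n h "S h v" v] by (simp add: e_def oddness_def flip: h_def)
    then show ?thesis using True q by (simp add: power_decreasing)
  next
    case False
    then have "oddness n (play S (xs @ [v])) = e"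
      using odd_roots_snoc_even[of v n h "S h v"] v
      by (simp add: e_def oddness_def A_def U_def flip: h_def)
    then show ?thesis using False by simp
  qed
  then have "(\<Sum>v\<in>U. q ^ oddness n (play S (xs @ [v]))) \<le>
      (\<Sum>v\<in>U. if v \<in> A then q ^ (e - 1) else q ^ e)" by (rule sum_mono)
  also have "\<dots> = (\<Sum>v\<in>U. q ^ e + (if v \<in> A then q ^ (e - 1) - q ^ e else 0))"
    by (intro sum.cong) auto
  also have "\<dots> = real (Suc s) * q ^ e + real (card A) * (q ^ (e - 1) - q ^ e)"
    using AU finU by (simp add: sum.distrib cardU sum.If_cases Int_absorb1)
  also have "\<dots> \<le> real (Suc s) * q ^ e + real (2 * e) * (q ^ (e - 1) - q ^ e)"
  proof -
    have "card A \<le> 2 * e" by (simp add: e_def oddness_def A_def)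
    moreover have "q ^ e \<le> q ^ (e - 1)" using q by (intro power_decreasing) auto
    ultimately show ?thesis
      by (intro add_left_mono mult_right_mono) (simp_all only: of_nat_le_iff diff_ge_0_iff_ge)
  qed
  \<comment> \<open>For \<open>e = 0\<close>, where \<open>e - 1\<close> is truncated, both sides
    vanish because of the factor \<open>2 * e\<close>.\<close>
  also have "real (2 * e) * (q ^ (e - 1) - q ^ e) = real (2 * e) * (1 - q) * q ^ (e - 1)"
    by (cases e) (simp_all add: algebra_simps)
  also have "real (Suc s) * q ^ e + real (2 * e) * (1 - q) * q ^ (e - 1) =
      real (Suc s) * (q ^ e + real e * (2 * (1 - q) / real (Suc s)) * q ^ (e - 1))"
    by (simp add: field_simps)
  also have "\<dots> \<le> real (Suc s) * (q + 2 * (1 - q) / real (Suc s)) ^ e"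
    using q by (intro mult_left_mono power_add_ge) auto
  also have "q + 2 * (1 - q) / real (Suc s) = pair_missed t (Suc s)"
    using t Suc_s(2) by (simp add: q_def pair_missed_Suc)
  finally show ?thesis unfolding s Suc_s(1) by (simp only: U_def q_def e_def h_def)
qed

lemma hit_prob_perfect_matchings_le:
  assumes t: "2 \<le> t" "t \<le> n"
  shows "hit_prob n (perfect_matchings n) S (n - t) \<le> exp (- (real t * (real t - 1) / (2 * real n)))"
proof -
  define \<Phi> where "\<Phi> xs = pair_missed t (n - length xs) ^ oddness n (play S xs)" for xs
  let ?P = "{p. p permutes {1..n}}"
  let ?H = "{p. p permutes {1..n} \<and> contains (perfect_matchings n) (play S (seq_prefix p (n - t)))}"
  have fin: "finite ?P" by (simp add: finite_permutations)
  have "real (card ?H) = (\<Sum>p\<in>?H. 1)" by simp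
  also have "\<dots> = (\<Sum>p\<in>?H. \<Phi> (seq_prefix p (n - t)))"
  proof (rule sum.cong[OF refl])
    fix p assume "p \<in> ?H"
    then have "odd_roots n (play S (seq_prefix p (n - t))) = {}"
      by (intro odd_roots_perfect_matching distinct_seq_prefix) auto
    \<comment> \<open>The base is \<open>pair_missed t t = 0\<close>, but with no odd root the
      exponent is 0, and \<open>0 ^ 0 = 1\<close>.\<close>
    then show "1 = \<Phi> (seq_prefix p (n - t))" by (simp add: \<Phi>_def oddness_def)
  qed
  also have "\<dots> \<le> (\<Sum>p\<in>?P. \<Phi> (seq_prefix p (n - t)))"
    using fin t pair_missed_bounds(1)[of t t] by (intro sum_mono2) (auto simp: \<Phi>_def)
  also have "\<dots> \<le> fact n * \<Phi> []"
    unfolding \<Phi>_def by (intro sum_permutes_supermartingale oddness_step t) auto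
  finally have "hit_prob n (perfect_matchings n) S (n - t) \<le> \<Phi> []"
    by (simp add: hit_prob_eq_card field_simps)
  \<comment> \<open>At the start every vertex is an odd tree of its own.\<close>
  also have "\<Phi> [] = pair_missed t n ^ ((n + 1) div 2)"
    by (simp add: \<Phi>_def oddness_def odd_roots_Nil)
  also have "\<dots> \<le> exp (- (real t * (real t - 1) / (real n * (real n - 1)))) ^ ((n + 1) div 2)"
    using pair_missed_bounds[OF t]
    using exp_ge_add_one_self[of "- (real t * (real t - 1) / (real n * (real n - 1)))"]
    by (intro power_mono) (auto simp: pair_missed_def)
  also have "\<dots> = exp (- (real ((n + 1) div 2) * (real t * (real t - 1) / (real n * (real n - 1)))))"
    by (simp flip: exp_of_nat_mult)
  also have "\<dots> \<le> exp (- (real t * (real t - 1) / (2 * real n)))"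
  proof -
    have "real n / 2 * (real t * (real t - 1) / (real n * real n)) \<le>
        real ((n + 1) div 2) * (real t * (real t - 1) / (real n * (real n - 1)))"
      using t by (intro mult_mono divide_left_mono) auto
    moreover have "real n / 2 * (real t * (real t - 1) / (real n * real n)) =
        real t * (real t - 1) / (2 * real n)" using t by simp
    ultimately show ?thesis by simp
  qed
  finally show ?thesis .
qed

subsection \<open>Perfect matchings up to isomorphism\<close>

lemma M0_eq_image: "M0 n = (\<lambda>i. {2 * i - 1, 2 * i}) ` {1..n div 2}"
  by (auto simp: M0_def)

lemma mem_M0_edge_iff:
  fixes i v :: nat
  assumes "1 \<le> i" "1 \<le> v"
  shows "v \<in> {2 * i - 1, 2 * i} \<longleftrightarrow> i = (v + 1) div 2"
  using assms unfolding insert_iff empty_iff by presburger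

lemma M0_perfect_matching:
  assumes "even n"
  shows "M0 n \<in> perfect_matchings n"
proof -
  have "M0 n \<in> labeled_graphs n"
    using assms by (auto simp: M0_eq_image labeled_graphs_def card_insert_if)
  moreover have "\<exists>!e. e \<in> M0 n \<and> v \<in> e" if v: "v \<in> {1..n}" for v
  proof -
    define j where "j = (v + 1) div 2"
    have j: "j \<in> {1..n div 2}" using v assms by (auto simp: j_def)
    have iff: "v \<in> {2 * i - 1, 2 * i} \<longleftrightarrow> i = j" if "i \<in> {1..n div 2}" for i
      using mem_M0_edge_iff[of i v] that v by (simp add: j_def)
    show ?thesis
    proof (rule ex1I[of _ "{2 * j - 1, 2 * j}"])
      show "{2 * j - 1, 2 * j} \<in> M0 n \<and> v \<in> {2 * j - 1, 2 * j}"
        using iff[OF j] j unfolding M0_eq_image by blast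
      show "e = {2 * j - 1, 2 * j}" if "e \<in> M0 n \<and> v \<in> e" for e
        using that iff unfolding M0_eq_image by blast
    qed
  qed
  ultimately show ?thesis by (auto simp: perfect_matchings_def)
qed

lemma perfect_matching_image:
  assumes M: "M \<in> perfect_matchings n" and p: "p permutes {1..n}"
  shows "(\<lambda>e. p ` e) ` M \<in> perfect_matchings n"
proof -
  have Mg: "e \<subseteq> {1..n}" "card e = 2" if "e \<in> M" for e
    using M that by (auto simp: perfect_matchings_def labeled_graphs_def)
  have inj: "inj p" by (rule permutes_inj[OF p])
  have "p ` e \<subseteq> {1..n}" "card (p ` e) = 2" if "e \<in> M" for e
    using Mg[OF that] permutes_image[OF p] card_image[OF inj_on_subset[OF inj subset_UNIV], of e] by auto
  then have "(\<lambda>e. p ` e) ` M \<in> labeled_graphs n"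
    unfolding labeled_graphs_def by blast
  moreover have "\<exists>!e. e \<in> (\<lambda>e. p ` e) ` M \<and> v \<in> e" if v: "v \<in> {1..n}" for v
  proof -
    obtain w where w: "w \<in> {1..n}" "v = p w" using v permutes_image[OF p] by blast
    have "\<exists>!e. e \<in> M \<and> w \<in> e" using M w(1) by (auto simp: perfect_matchings_def)
    then obtain e where e: "e \<in> M" "w \<in> e" "\<And>e'. e' \<in> M \<Longrightarrow> w \<in> e' \<Longrightarrow> e' = e" by metis
    show ?thesis
    proof (rule ex1I[of _ "p ` e"])
      show "p ` e \<in> (\<lambda>e. p ` e) ` M \<and> v \<in> p ` e" using e w(2) by blast
      fix d assume "d \<in> (\<lambda>e. p ` e) ` M \<and> v \<in> d"
      then obtain e' where e': "e' \<in> M" "d = p ` e'" "p w \<in> p ` e'"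
        unfolding w(2) by (elim conjE imageE) simp
      then have "w \<in> e'" by (simp add: inj_image_mem_iff[OF inj])
      then show "d = p ` e" using e(3) e' by simp
    qed
  qed
  ultimately show ?thesis by (auto simp: perfect_matchings_def)
qed

text \<open>Number the edges of \<open>M\<close> and order the two ends of each. The permutation
  sends \<open>2 * i - 1\<close> and \<open>2 * i\<close> to the first and second end of the
  \<open>i\<close>-th edge.\<close>

lemma perfect_matching_iso_M0:
  assumes M: "M \<in> perfect_matchings n"
  obtains p where "p permutes {1..n}" "M = (\<lambda>e. p ` e) ` M0 n"
proof -
  have Mg: "e \<subseteq> {1..n}" "card e = 2" if "e \<in> M" for e
    using M that by (auto simp: perfect_matchings_def labeled_graphs_def)
  have uniq: "e = e'" if "e \<in> M" "e' \<in> M" "v \<in> e" "v \<in> e'" for v e e'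
  proof -
    have "v \<in> {1..n}" using Mg(1) that by blast
    then have "\<exists>!e. e \<in> M \<and> v \<in> e" using M by (auto simp: perfect_matchings_def)
    then show ?thesis using that by blast
  qed
  have "{e \<in> M. e \<subseteq> {1..n}} = M" using Mg(1) by blast
  then have n: "n = 2 * card M"
    using card_perfect_matching_closed[OF M, of "{1..n}"] Mg(1) by simp
  have "finite M" using Mg(1) by (intro finite_subset[of M "Pow {1..n}"]) auto
  from ex_bij_betw_nat_finite_1[OF this]
  obtain E where E: "bij_betw E {1..n div 2} M" using n by auto
  have "\<exists>a b. e = {a, b} \<and> a \<noteq> b" if "e \<in> M" for e
    using Mg(2)[OF that] by (auto simp: card_2_iff)
  then obtain a b where ab: "\<And>e. e \<in> M \<Longrightarrow> e = {a e, b e} \<and> a e \<noteq> b e" by metis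
  define p where "p v = (if v \<in> {1..n} then
      (if odd v then a (E ((v + 1) div 2)) else b (E ((v + 1) div 2))) else v)" for v
  have idx: "(v + 1) div 2 \<in> {1..n div 2}" if "v \<in> {1..n}" for v
    using that n by auto
  have EM: "E i \<in> M" if "i \<in> {1..n div 2}" for i
    using bij_betw_apply[OF E that] .
  have mem: "p v \<in> E ((v + 1) div 2)" if "v \<in> {1..n}" for v
    using ab[OF EM[OF idx[OF that]]] that by (auto simp: p_def)
  have "inj_on p {1..n}"
  \<comment> \<open>Equal images lie in the same edge, which fixes the index
    \<open>(v + 1) div 2\<close>; the two ends of that edge differ, which fixes the parity.\<close>
  proof (rule inj_onI)
    fix v w assume vw: "v \<in> {1..n}" "w \<in> {1..n}" "p v = p w"
    have "E ((v + 1) div 2) = E ((w + 1) div 2)"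
      using uniq[OF EM[OF idx] EM[OF idx], of v w "p v"] mem vw by metis
    then have i: "(v + 1) div 2 = (w + 1) div 2"
      using bij_betw_imp_inj_on[OF E] idx vw by (metis inj_onD)
    moreover have "odd v \<longleftrightarrow> odd w"
      using ab[OF EM[OF idx[OF vw(1)]]] vw i by (auto simp: p_def split: if_splits)
    ultimately show "v = w" by presburger
  qed
  moreover have "p ` {1..n} \<subseteq> {1..n}" using mem Mg(1)[OF EM[OF idx]] by blast
  ultimately have "bij_betw p {1..n} {1..n}"
    by (simp add: bij_betw_def endo_inj_surj)
  then have "p permutes {1..n}" by (rule bij_imp_permutes) (simp only: p_def if_False)
  moreover have "p ` {2 * i - 1, 2 * i} = E i" if i: "i \<in> {1..n div 2}" for i
  proof -
    have "p (2 * i - 1) = a (E i)" "p (2 * i) = b (E i)"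
      using i by (auto simp: p_def Suc_diff_Suc)
    then show ?thesis using ab[OF EM[OF i]] by simp
  qed
  then have "(\<lambda>e. p ` e) ` M0 n = E ` {1..n div 2}"
    unfolding M0_eq_image image_image by (intro image_cong) auto
  then have "M = (\<lambda>e. p ` e) ` M0 n" using E by (simp add: bij_betw_def)
  ultimately show thesis by (rule that)
qed

lemma perfect_matchings_labeled: "perfect_matchings n \<subseteq> labeled_graphs n"
  by (auto simp: perfect_matchings_def)

lemma iso_closure_perfect_matchings:
  "iso_closure n (perfect_matchings n) = perfect_matchings n"
proof
  show "iso_closure n (perfect_matchings n) \<subseteq> perfect_matchings n"
    by (auto simp: iso_closure_def perfect_matching_image)
qed (rule subset_iso_closure[OF perfect_matchings_labeled])

text \<open>The coupling compares \<open>{M0 n}\<close> with its isomorphism closure; this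
  identifies the closure, so that the comparison concerns perfect matchings.\<close>

lemma iso_closure_M0:
  assumes "even n"
  shows "iso_closure n {M0 n} = perfect_matchings n"
proof
  show "iso_closure n {M0 n} \<subseteq> perfect_matchings n"
    using perfect_matching_image[OF M0_perfect_matching[OF assms]]
    by (auto simp: iso_closure_def)
  show "perfect_matchings n \<subseteq> iso_closure n {M0 n}"
  proof
    fix M assume M: "M \<in> perfect_matchings n"
    then obtain p where "p permutes {1..n}" "M = (\<lambda>e. p ` e) ` M0 n"
      by (rule perfect_matching_iso_M0)
    then show "M \<in> iso_closure n {M0 n}"
      using M perfect_matchings_labeled by (auto simp: iso_closure_def)
  qed
qed

subsection \<open>The fixed matching\<close>

text \<open>While the pair is unseen and \<open>s\<close> vertices remain, \<open>s - 2\<close>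
  choices keep it unseen. Hence the indicator divided by \<open>s * (s - 1)\<close> keeps its
  mean.\<close>

lemma card_permutes_avoiding_pair:
  assumes xy: "x \<in> {1..n}" "y \<in> {1..n}" "x \<noteq> y" and t: "2 \<le> t" "t \<le> n"
  shows "real (card {p. p permutes {1..n} \<and> x \<notin> set (seq_prefix p (n - t)) \<and> y \<notin> set (seq_prefix p (n - t))})
    \<le> fact n * (real t * (real t - 1) / (real n * (real n - 1)))"
proof -
  define \<Phi> where "\<Phi> xs = of_bool (x \<notin> set xs \<and> y \<notin> set xs) /
      (real (n - length xs) * (real (n - length xs) - 1))" for xs
  let ?P = "{p. p permutes {1..n}}"
  let ?Q = "{p. p permutes {1..n} \<and> x \<notin> set (seq_prefix p (n - t)) \<and> y \<notin> set (seq_prefix p (n - t))}"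
  have step: "(\<Sum>v \<in> {1..n} - set xs. \<Phi> (xs @ [v])) \<le> real (n - length xs) * \<Phi> xs"
    if xs: "distinct xs" "set xs \<subseteq> {1..n}" "length xs < n - t" for xs
  proof (cases "x \<notin> set xs \<and> y \<notin> set xs")
    case True
    define s where "s = n - length xs"
    \<comment> \<open>This makes \<open>s - 2\<close> nonzero, so that it cancels below.\<close>
    have s: "3 \<le> s" using xs t by (simp add: s_def)
    let ?U = "{1..n} - set xs"
    have "card ?U = s" using xs by (simp add: card_Diff_subset distinct_card s_def)
    then have card: "card (?U - {x, y}) = s - 2"
      using True xy by (subst card_Diff_subset) auto
    have "(\<Sum>v\<in>?U. \<Phi> (xs @ [v])) =
        (\<Sum>v\<in>?U. if v \<in> ?U - {x, y} then 1 / ((real s - 1) * (real s - 2)) else 0)"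
      using True s by (intro sum.cong) (auto simp: \<Phi>_def s_def of_nat_diff)
    also have "\<dots> = real (s - 2) * (1 / ((real s - 1) * (real s - 2)))"
      by (subst sum.inter_restrict[symmetric]) (simp_all add: Int_absorb1 card[simplified])
    also have "\<dots> = real s * (1 / (real s * (real s - 1)))"
      using s by (simp add: of_nat_diff)
    finally show ?thesis using True by (simp add: \<Phi>_def s_def)
  next
    case False
    then show ?thesis by (auto simp: \<Phi>_def)
  qed
  have "real (card ?Q) / (real t * (real t - 1)) = (\<Sum>p\<in>?Q. 1 / (real t * (real t - 1)))"
    by simp
  also have "\<dots> = (\<Sum>p\<in>?Q. \<Phi> (seq_prefix p (n - t)))"
    using t by (intro sum.cong) (auto simp: \<Phi>_def)
  also have "\<dots> \<le> (\<Sum>p\<in>?P. \<Phi> (seq_prefix p (n - t)))"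
    using t by (intro sum_mono2) (auto simp: \<Phi>_def finite_permutations)
  also have "\<dots> \<le> fact n * \<Phi> []"
    by (intro sum_permutes_supermartingale step) auto
  also have "\<Phi> [] = 1 / (real n * (real n - 1))" by (simp add: \<Phi>_def)
  finally show ?thesis using t by (simp add: field_simps)
qed

text \<open>The default value 1 keeps the choice in \<open>{1..n}\<close> for every argument, as
  \<open>strategies\<close> demands.\<close>

definition partner_strategy :: "nat \<Rightarrow> strategy" where
  "partner_strategy n h v = (if v \<in> {1..n} then (if odd v then v + 1 else v - 1) else 1)"

lemma partner_strategy_in_strategies:
  assumes "even n" "0 < n"
  shows "partner_strategy n \<in> strategies n"
proof -
  have "v + 1 \<le> n" if "odd v" "v \<le> n" for v :: nat
    using that assms by (metis Suc_eq_plus1 Suc_leI le_neq_implies_less)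
  then show ?thesis using assms by (auto simp: strategies_def partner_strategy_def)
qed

text \<open>The choice ignores the history, so \<open>[]\<close> can stand for all of them.\<close>

lemma set_play_partner:
  "set (play (partner_strategy n) xs) = (\<lambda>v. (partner_strategy n [] v, v)) ` set xs"
proof (induction xs rule: rev_induct)
  case (snoc v xs)
  then show ?case by (simp add: partner_strategy_def)
qed simp

lemma contains_M0_partner:
  assumes xs: "set xs \<subseteq> {1..n}"
    and hit: "\<And>i. i \<in> {1..n div 2} \<Longrightarrow> 2 * i - 1 \<in> set xs \<or> 2 * i \<in> set xs"
  shows "contains {M0 n} (play (partner_strategy n) xs)"
proof -
  have "{2 * i - 1, 2 * i} \<in> (\<lambda>(u, w). {u, w}) ` set (play (partner_strategy n) xs)"
    if i: "i \<in> {1..n div 2}" for i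
    using hit[OF i]
  proof
    assume w: "2 * i - 1 \<in> set xs"
    have "partner_strategy n [] (2 * i - 1) = 2 * i"
      using i xs w by (auto simp: partner_strategy_def)
    then show ?thesis
      using w unfolding set_play_partner image_image
      by (intro image_eqI[of _ _ "2 * i - 1"]) auto
  next
    assume w: "2 * i \<in> set xs"
    have "partner_strategy n [] (2 * i) = 2 * i - 1"
      using i xs w by (auto simp: partner_strategy_def)
    then show ?thesis
      using w unfolding set_play_partner image_image
      by (intro image_eqI[of _ _ "2 * i"]) auto
  qed
  then have "M0 n \<subseteq> (\<lambda>(u, w). {u, w}) ` set (play (partner_strategy n) xs)"
    unfolding M0_eq_image by (rule image_subsetI)
  then show ?thesis by (simp add: contains_def)
qed

text \<open>A union bound over the \<open>n div 2\<close> pairs, each of which is missed with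
  probability at most \<open>t * (t - 1) / (n * (n - 1))\<close>.\<close>

lemma hit_prob_M0_ge:
  assumes n: "even n" and t: "2 \<le> t" "t \<le> n"
  shows "1 - (real t)\<^sup>2 / real n \<le> hit_prob n {M0 n} (partner_strategy n) (n - t)"
proof -
  let ?P = "{p. p permutes {1..n}}"
  let ?H = "{p. p permutes {1..n} \<and> contains {M0 n} (play (partner_strategy n) (seq_prefix p (n - t)))}"
  let ?B = "\<lambda>i. {p. p permutes {1..n} \<and>
      2 * i - 1 \<notin> set (seq_prefix p (n - t)) \<and> 2 * i \<notin> set (seq_prefix p (n - t))}"
  have fin: "finite ?P" by (simp add: finite_permutations)
  have "?P \<subseteq> ?H \<union> (\<Union>i\<in>{1..n div 2}. ?B i)"
  proof
    fix p assume p: "p \<in> ?P"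
    have "set (seq_prefix p (n - t)) \<subseteq> {1..n}" using p by (intro distinct_seq_prefix) auto
    from contains_M0_partner[OF this] p
    show "p \<in> ?H \<union> (\<Union>i\<in>{1..n div 2}. ?B i)" by blast
  qed
  then have "card ?P \<le> card (?H \<union> (\<Union>i\<in>{1..n div 2}. ?B i))"
    by (rule card_mono[rotated]) (auto intro: finite_subset[OF _ fin])
  also have "\<dots> \<le> card ?H + (\<Sum>i\<in>{1..n div 2}. card (?B i))"
    by (rule order_trans[OF card_Un_le add_left_mono[OF card_UN_le]]) simp
  finally have "real (card ?P) \<le> real (card ?H + (\<Sum>i\<in>{1..n div 2}. card (?B i)))"
    by (simp only: of_nat_le_iff)
  then have "fact n \<le> real (card ?H) + (\<Sum>i\<in>{1..n div 2}. real (card (?B i)))"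
    by (simp add: card_permutations)
  also have "(\<Sum>i\<in>{1..n div 2}. real (card (?B i))) \<le>
      (\<Sum>i\<in>{1..n div 2}. fact n * (real t * (real t - 1) / (real n * (real n - 1))))"
    using t by (intro sum_mono card_permutes_avoiding_pair) auto
  also have "\<dots> = fact n * (real (n div 2) * (real t * (real t - 1) / (real n * (real n - 1))))"
    by simp
  also have "real (n div 2) * (real t * (real t - 1) / (real n * (real n - 1))) =
      real t * (real t - 1) / (2 * (real n - 1))"
    using n t by (simp add: real_of_nat_div)
  also have "\<dots> \<le> (real t)\<^sup>2 / real n"
    using t by (intro frac_le) (auto simp: power2_eq_square)
  finally have "fact n * (1 - (real t)\<^sup>2 / real n) \<le> real (card ?H)"
    by (simp add: algebra_simps)
  then show ?thesis by (simp add: hit_prob_eq_card field_simps)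
qed

subsection \<open>Tails of the hitting times\<close>

text \<open>Since \<open>enat\<close> is countable, any relation between two such variables defines
  a countable union of measurable events.\<close>

lemma measurable_count_space_pred2:
  fixes X Y :: "'a \<Rightarrow> enat"
  assumes X: "X \<in> M \<rightarrow>\<^sub>M count_space UNIV" and Y: "Y \<in> M \<rightarrow>\<^sub>M count_space UNIV"
  shows "{\<omega> \<in> space M. P (X \<omega>) (Y \<omega>)} \<in> sets M"
proof -
  have "{\<omega> \<in> space M. P (X \<omega>) (Y \<omega>)} =
      (\<Union>(a, b) \<in> {(a, b). P a b}. (X -` {a} \<inter> space M) \<inter> (Y -` {b} \<inter> space M))"
    by auto
  also have "\<dots> \<in> sets M"
    by (intro sets.countable_UN'') (auto intro!: sets.Int measurable_sets[OF X] measurable_sets[OF Y])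
  finally show ?thesis .
qed

context
  fixes M :: "'a measure" and n :: nat and \<tau>lab :: "nat set set set \<Rightarrow> 'a \<Rightarrow> enat"
  assumes coupling: "tau_coupling M n \<tau>lab" and n: "even n" "0 < n"
begin

lemma tau_measurable:
  assumes "F \<subseteq> labeled_graphs n"
  shows "\<tau>lab F \<in> M \<rightarrow>\<^sub>M count_space UNIV"
  using coupling assms by (auto simp: tau_coupling_def is_tau_lab_def)

lemma M0_labeled: "{M0 n} \<subseteq> labeled_graphs n"
  using M0_perfect_matching[OF n(1)] perfect_matchings_labeled by auto

text \<open>The maximum over strategies is attained, so the bound valid for each single strategy
  carries over. It is applied both to all perfect matchings and to \<open>{M0 n}\<close>.\<close>

lemma tau_matching_lower_tail:
  assumes F: "F \<subseteq> perfect_matchings n" and t: "2 \<le> t" "t \<le> n"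
  shows "measure M {\<omega> \<in> space M. \<tau>lab F \<omega> \<le> enat (n - t)} \<le>
    exp (- (real t * (real t - 1) / (2 * real n)))"
proof -
  have "is_tau_lab M n F (\<tau>lab F)"
    using coupling order_trans[OF F perfect_matchings_labeled] by (simp add: tau_coupling_def)
  then obtain S where
    "hit_prob n F S (n - t) = measure M {\<omega> \<in> space M. \<tau>lab F \<omega> \<le> enat (n - t)}"
    unfolding is_tau_lab_def by metis
  then show ?thesis
    using hit_prob_mono_family[of n F "perfect_matchings n" S "n - t"] F n
      hit_prob_perfect_matchings_le[OF t, of S] by simp
qed

lemma tau_M0_upper_tail:
  assumes t: "2 \<le> t" "t \<le> n"
  shows "1 - (real t)\<^sup>2 / real n \<le> measure M {\<omega> \<in> space M. \<tau>lab {M0 n} \<omega> \<le> enat (n - t)}"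
proof -
  have "is_tau_lab M n {M0 n} (\<tau>lab {M0 n})"
    using coupling M0_labeled by (simp add: tau_coupling_def)
  then have "hit_prob n {M0 n} (partner_strategy n) (n - t) \<le>
      measure M {\<omega> \<in> space M. \<tau>lab {M0 n} \<omega> \<le> enat (n - t)}"
    using partner_strategy_in_strategies[OF n] unfolding is_tau_lab_def by blast
  then show ?thesis using hit_prob_M0_ge[OF n(1) t] by simp
qed

lemma tau_perfect_matchings_whp:
  assumes t: "2 \<le> t"
  shows "1 - exp (- (real t * (real t - 1) / (2 * real n))) \<le>
    measure M {\<omega> \<in> space M.
      ereal (real n - real t) \<le> ereal_of_enat (\<tau>lab (perfect_matchings n) \<omega>) \<and>
      \<tau>lab (perfect_matchings n) \<omega> \<le> \<tau>lab {M0 n} \<omega>}" (is "_ \<le> measure M ?E")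
proof -
  let ?X = "\<tau>lab (perfect_matchings n)" and ?Y = "\<tau>lab {M0 n}"
  interpret prob_space M using coupling by (simp add: tau_coupling_def)
  note meas = tau_measurable[OF perfect_matchings_labeled] tau_measurable[OF M0_labeled]
  have ae: "AE \<omega> in M. ?X \<omega> \<le> ?Y \<omega>"
    using coupling M0_labeled iso_closure_M0[OF n(1)] unfolding tau_coupling_def by metis
  \<comment> \<open>For \<open>t > n\<close> the difference \<open>n - t\<close> would be truncated
    to 0, whereas the real lower bound holds trivially; the conjunct \<open>t \<le> n\<close> makes
    the bad event empty then.\<close>
  let ?B = "{\<omega> \<in> space M. t \<le> n \<and> ?X \<omega> \<le> enat (n - t)}"
  have B: "?B \<in> sets M" by (rule measurable_count_space_pred2[OF meas(1) meas(1)])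
  have E: "?E \<in> sets M" by (rule measurable_count_space_pred2[OF meas])
  have "ereal (real n - real t) \<le> ereal_of_enat x" if "\<not> (t \<le> n \<and> x \<le> enat (n - t))" for x
    using that by (cases x) auto
  then have "prob (space M - ?B) \<le> prob ?E"
    using ae by (intro finite_measure_mono_AE[OF _ E]) auto
  moreover have "prob ?B \<le> exp (- (real t * (real t - 1) / (2 * real n)))"
    using tau_matching_lower_tail[OF order_refl t] by (cases "t \<le> n") auto
  ultimately show ?thesis using prob_compl[OF B] by linarith
qed

text \<open>Reaching \<open>M0 n\<close> by round \<open>n - t2\<close> but not by round
  \<open>n - t1\<close> puts the hitting time in the window. Separate reals \<open>x1\<close> and
  \<open>x2\<close> leave room for rounding.\<close>

lemma tau_M0_window:
  assumes t: "2 \<le> t1" "t1 \<le> n" "2 \<le> t2" "t2 \<le> n"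
    and x: "real t1 \<le> x1" "x2 \<le> real t2"
  shows "1 - (real t2)\<^sup>2 / real n - exp (- (real t1 * (real t1 - 1) / (2 * real n))) \<le>
    measure M {\<omega> \<in> space M. ereal (real n - x1) \<le> ereal_of_enat (\<tau>lab {M0 n} \<omega>) \<and>
      ereal_of_enat (\<tau>lab {M0 n} \<omega>) \<le> ereal (real n - x2)}" (is "_ \<le> measure M ?E")
proof -
  let ?Y = "\<tau>lab {M0 n}"
  interpret prob_space M using coupling by (simp add: tau_coupling_def)
  note meas = tau_measurable[OF M0_labeled]
  let ?A = "{\<omega> \<in> space M. ?Y \<omega> \<le> enat (n - t2)}" and ?B = "{\<omega> \<in> space M. ?Y \<omega> \<le> enat (n - t1)}"
  have sets: "?A \<in> sets M" "?B \<in> sets M" "?E \<in> sets M"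
    by (rule measurable_count_space_pred2[OF meas meas])+
  have "ereal (real n - x1) \<le> ereal_of_enat y \<and> ereal_of_enat y \<le> ereal (real n - x2)"
    if "y \<le> enat (n - t2)" "\<not> y \<le> enat (n - t1)" for y
    using that x t by (cases y) auto
  then have "?A \<subseteq> ?E \<union> ?B" by auto
  then have "prob ?A \<le> prob (?E \<union> ?B)" using sets by (intro finite_measure_mono) auto
  also have "\<dots> \<le> prob ?E + prob ?B" using sets by (intro measure_Un_le) auto
  also have "prob ?B \<le> exp (- (real t1 * (real t1 - 1) / (2 * real n)))"
    using M0_perfect_matching[OF n(1)] t by (intro tau_matching_lower_tail) auto
  finally show ?thesis using tau_M0_upper_tail[OF t(3,4)] by linarith
qed

end

text \<open>The Theta term is read as tightness: at \<open>C * sqrt n\<close> and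
  \<open>c * sqrt n\<close> the tail bounds tend to positive constants, so \<open>c\<close> and
  \<open>C\<close> are chosen for each tolerated failure probability. Limits run along even
  \<open>n\<close>.\<close>

theorem theorem6p1:
  fixes \<Omega> :: "nat \<Rightarrow> 'a measure"
    and \<tau>lab :: "nat \<Rightarrow> nat set set set \<Rightarrow> 'a \<Rightarrow> enat"
    and f :: "nat \<Rightarrow> nat"
  assumes coupling: "\<And>n. even n \<Longrightarrow> 0 < n \<Longrightarrow> tau_coupling (\<Omega> n) n (\<tau>lab n)"
    and f: "(\<lambda>n. real (f n)) \<in> \<omega>(\<lambda>n. real n powr (3 / 4))"
  shows
    "((\<lambda>n. measure (\<Omega> n) {\<omega> \<in> space (\<Omega> n).
          ereal (real n - real (f n)) \<le> ereal_of_enat (\<tau>lab n (iso_closure n (perfect_matchings n)) \<omega>) \<and>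
          \<tau>lab n (iso_closure n (perfect_matchings n)) \<omega> \<le> \<tau>lab n {M0 n} \<omega>})
        \<longlongrightarrow> 1) (inf at_top (principal {n. even n})) \<and>
     (\<forall>\<epsilon>>0. \<exists>c>0. \<exists>C>0. \<forall>\<^sub>F n in inf at_top (principal {n. even n}).
        1 - \<epsilon> \<le> measure (\<Omega> n) {\<omega> \<in> space (\<Omega> n).
          ereal (real n - C * sqrt (real n)) \<le> ereal_of_enat (\<tau>lab n {M0 n} \<omega>) \<and>
          ereal_of_enat (\<tau>lab n {M0 n} \<omega>) \<le> ereal (real n - c * sqrt (real n))})"
    (is "(?p \<longlongrightarrow> 1) ?F \<and> ?window")
proof
  have evenF: "\<forall>\<^sub>F n in ?F. even n"
    by (simp add: eventually_inf_principal)
  have F_le: "?F \<le> at_top" by simp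
  have large: "\<forall>\<^sub>F n in ?F. P n" if "eventually P at_top" for P
    using that F_le by (rule filter_leD[rotated])
  show "(?p \<longlongrightarrow> 1) ?F"
  proof (rule tendsto_sandwich)
    \<comment> \<open>Here \<open>n powr (3 / 4)\<close> replaces \<open>f n\<close>, which
      eventually is at least as large; the exponent then grows like
      \<open>sqrt n / 2\<close>.\<close>
    let ?g = "\<lambda>n. 1 - exp (- (real n powr (3 / 4) * (real n powr (3 / 4) - 1) / (2 * real n)))"
    have "?g \<longlonglongrightarrow> 1" by real_asymp
    then show "(?g \<longlongrightarrow> 1) ?F" by (rule tendsto_mono[OF F_le])
    have "\<forall>\<^sub>F n in at_top. 1 * norm (real n powr (3 / 4)) \<le> norm (real (f n))"
      using landau_omega.smallD[OF f, of 1] by simp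
    moreover have "\<forall>\<^sub>F n in at_top. 2 \<le> real n powr (3 / 4)" by real_asymp
    ultimately have "\<forall>\<^sub>F n in at_top. 0 < n \<and> 2 \<le> f n \<and> 2 \<le> real n powr (3 / 4) \<and> real n powr (3 / 4) \<le> real (f n)"
      using eventually_gt_at_top[of 0] by eventually_elim simp
    from evenF large[OF this] show "\<forall>\<^sub>F n in ?F. ?g n \<le> ?p n"
    proof eventually_elim
      case (elim n)
      have "real n powr (3 / 4) * (real n powr (3 / 4) - 1) / (2 * real n) \<le>
          real (f n) * (real (f n) - 1) / (2 * real n)"
        using elim by (intro divide_right_mono mult_mono) auto
      then have "?g n \<le> 1 - exp (- (real (f n) * (real (f n) - 1) / (2 * real n)))" by simp
      also have "\<dots> \<le> ?p n"
        unfolding iso_closure_perfect_matchings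
        using elim by (intro tau_perfect_matchings_whp coupling) auto
      finally show ?case .
    qed
    from evenF large[OF eventually_gt_at_top[of 0]] show "\<forall>\<^sub>F n in ?F. ?p n \<le> 1"
    proof eventually_elim
      case (elim n)
      then interpret prob_space "\<Omega> n" using coupling by (simp add: tau_coupling_def)
      show ?case by simp
    qed
    show "((\<lambda>n. 1) \<longlongrightarrow> (1::real)) ?F" by simp
  qed
  show ?window
  proof (intro allI impI)
    fix \<epsilon> :: real assume \<epsilon>: "0 < \<epsilon>"
    \<comment> \<open>With \<open>t2 \<le> 2 * c * r\<close> one tail is at most
      \<open>4 * c\<^sup>2 = \<epsilon> / 4\<close>. The exponent of the other is at least
      \<open>C\<^sup>2 / 8 = 2 / \<epsilon>\<close>, and
      \<open>exp (- (2 / \<epsilon>)) \<le> \<epsilon> / 2\<close>.\<close>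
    define c C where "c = sqrt \<epsilon> / 4" and "C = 4 / sqrt \<epsilon>"
    have cC: "0 < c" "0 < C" "c\<^sup>2 = \<epsilon> / 16" "C\<^sup>2 = 16 / \<epsilon>"
      using \<epsilon> by (auto simp: c_def C_def power_divide)
    \<comment> \<open>Beyond \<open>R\<close> both rounded thresholds lie between 2 and
      \<open>n\<close>, and rounding costs at most a factor 2: \<open>t1 - 1 \<ge> C * r / 2\<close>
      and \<open>t2 \<le> 2 * c * r\<close>.\<close>
    define R where "R = Max {4 / C, C, 2 / c, 2 * c}"
    have "\<forall>\<^sub>F n in at_top. R \<le> sqrt (real n)" by real_asymp
    from evenF large[OF this] large[OF eventually_gt_at_top[of 0]]
    have "\<forall>\<^sub>F n in ?F. 1 - \<epsilon> \<le> measure (\<Omega> n) {\<omega> \<in> space (\<Omega> n).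
          ereal (real n - C * sqrt (real n)) \<le> ereal_of_enat (\<tau>lab n {M0 n} \<omega>) \<and>
          ereal_of_enat (\<tau>lab n {M0 n} \<omega>) \<le> ereal (real n - c * sqrt (real n))}"
    proof eventually_elim
      case (elim n)
      define r where "r = sqrt (real n)"
      have r2: "r\<^sup>2 = real n" "0 < r" using elim by (auto simp: r_def)
      have "4 / C \<le> r" "C \<le> r" "2 / c \<le> r" "2 * c \<le> r"
        using elim(2) by (auto simp: R_def r_def)
      then have "4 \<le> C * r" "C * r \<le> r * r" "2 \<le> c * r" "(2 * c) * r \<le> r * r"
        using cC(1,2) r2(2) by (simp_all add: field_simps)
      then have r: "4 \<le> C * r" "C * r \<le> real n" "2 \<le> c * r" "2 * c * r \<le> real n"
        using r2(1) by (simp_all add: power2_eq_square)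
      \<comment> \<open>Rounding \<open>t1\<close> down and \<open>t2\<close> up keeps the integer
        window inside the real one.\<close>
      define t1 t2 where "t1 = nat \<lfloor>C * r\<rfloor>" and "t2 = nat \<lceil>c * r\<rceil>"
      have t1: "C * r - 1 \<le> real t1" "real t1 \<le> C * r"
        using r unfolding t1_def by linarith+
      have t2: "c * r \<le> real t2" "real t2 \<le> c * r + 1"
        using r unfolding t2_def by linarith+
      have bnds: "2 \<le> t1" "t1 \<le> n" "2 \<le> t2" "t2 \<le> n" using r t1 t2 by linarith+
      have "(real t2)\<^sup>2 \<le> (2 * (c * r))\<^sup>2" using t2 r by (intro power_mono) auto
      also have "\<dots> = \<epsilon> / 4 * real n" by (simp add: power_mult_distrib cC r2)
      finally have small2: "(real t2)\<^sup>2 / real n \<le> \<epsilon> / 4" using r2 elim by (simp add: field_simps)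
      have "2 / \<epsilon> * (2 * real n) = (C * r / 2) * (C * r / 2)"
        by (simp add: power2_eq_square[symmetric] power_divide power_mult_distrib cC r2)
      also have "\<dots> \<le> real t1 * (real t1 - 1)" using r t1 by (intro mult_mono) auto
      finally have "2 / \<epsilon> \<le> real t1 * (real t1 - 1) / (2 * real n)"
        using elim by (simp add: pos_le_divide_eq)
      then have "exp (- (real t1 * (real t1 - 1) / (2 * real n))) \<le> exp (- (2 / \<epsilon>))" by simp
      also have "\<dots> \<le> \<epsilon> / 2"
        using exp_ge_add_one_self[of "2 / \<epsilon>"] \<epsilon> by (simp add: exp_minus field_simps)
      finally have "1 - \<epsilon> \<le> 1 - (real t2)\<^sup>2 / real n -
          exp (- (real t1 * (real t1 - 1) / (2 * real n)))"
        using small2 \<epsilon> by linarith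
      also have "\<dots> \<le> measure (\<Omega> n) {\<omega> \<in> space (\<Omega> n).
          ereal (real n - C * r) \<le> ereal_of_enat (\<tau>lab n {M0 n} \<omega>) \<and>
          ereal_of_enat (\<tau>lab n {M0 n} \<omega>) \<le> ereal (real n - c * r)}"
        using elim bnds t1 t2 by (intro tau_M0_window coupling) auto
      finally show ?case unfolding r_def .
    qed
    then show "\<exists>c>0. \<exists>C>0. \<forall>\<^sub>F n in ?F. 1 - \<epsilon> \<le> measure (\<Omega> n) {\<omega> \<in> space (\<Omega> n).
          ereal (real n - C * sqrt (real n)) \<le> ereal_of_enat (\<tau>lab n {M0 n} \<omega>) \<and>
          ereal_of_enat (\<tau>lab n {M0 n} \<omega>) \<le> ereal (real n - c * sqrt (real n))}"
      using cC(1,2) by blast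
  qed
qed

end
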